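(* Let $n\ge 2$ and let $\mathbb{X}$ be the two-dimensional polyhedral Banach space (that is, $\mathbb{R}^2$ with a norm) whose unit sphere is the regular $2n$-gon with vertices $$v_j=\Big(\cos\frac{(j-1)\pi}{n},\ \sin\frac{(j-1)\pi}{n}\Big),\quad 1\le j\le 2n.$$ If a linear operator $T:\mathbb{X}\to\mathbb{X}$ preserves Birkhoff-James orthogonality at any two consecutive vertices of $S_{\mathbb{X}}$ (i.e., at $v_i$ and $v_{i+1}$ for some $1\le i\le 2n$, where $v_{2n+1}=v_1$), then $T$ is a scalar multiple of an isometry.
   Context: A finite-dimensional real Banach space is polyhedral if its unit ball has only finitely many extreme points. $S_{\mathbb{X}}$ is the unit sphere of $\mathbb{X}$. For $x,y\in\mathbb{X}$, $x\perp_B y$ (Birkhoff-James orthogonality) means $\|x+\lambda y\|\ge\|x\|$ for all scalars $\lambda$. $T$ preserves Birkhoff-James orthogonality at $x$ if for every $y\in\mathbb{X}$, $x\perp_B y$ implies $Tx\perp_B Ty$. An isometry is a linear operator $S$ with $\|Sx\|=\|x\|$ for all $x$; scalar multiples include the zero multiple. *)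

theory Defs
  imports "HOL-Analysis.Analysis"
begin

text \<open>The type class norm on \<^typ>\<open>real ^ 2\<close> is the Euclidean one, so the norm of the space
  is an explicit function \<open>N\<close>. The vector space structure, convex hulls and the (norm-independent)
  topology are those of the library.\<close>

definition is_norm :: "('a::real_vector \<Rightarrow> real) \<Rightarrow> bool" where
  "is_norm N \<longleftrightarrow>
     (\<forall>x. 0 \<le> N x) \<and>
     (\<forall>x. N x = 0 \<longleftrightarrow> x = 0) \<and>
     (\<forall>a x. N (a *\<^sub>R x) = \<bar>a\<bar> * N x) \<and>
     (\<forall>x y. N (x + y) \<le> N x + N y)"

definition unit_sphere :: "('a::real_vector \<Rightarrow> real) \<Rightarrow> 'a set" where
  "unit_sphere N = {x. N x = 1}"

definition birkhoff_james :: "('a::real_vector \<Rightarrow> real) \<Rightarrow> 'a \<Rightarrow> 'a \<Rightarrow> bool" where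
  "birkhoff_james N x y \<longleftrightarrow> (\<forall>c. N (x + c *\<^sub>R y) \<ge> N x)"

definition preserves_birkhoff_james_at ::
    "('a::real_vector \<Rightarrow> real) \<Rightarrow> ('a \<Rightarrow> 'a) \<Rightarrow> 'a \<Rightarrow> bool" where
  "preserves_birkhoff_james_at N T x \<longleftrightarrow>
     (\<forall>y. birkhoff_james N x y \<longrightarrow> birkhoff_james N (T x) (T y))"

definition linear_isometry :: "('a::real_vector \<Rightarrow> real) \<Rightarrow> ('a \<Rightarrow> 'a) \<Rightarrow> bool" where
  "linear_isometry N S \<longleftrightarrow> linear S \<and> (\<forall>x. N (S x) = N x)"

definition polygon_vertex :: "nat \<Rightarrow> nat \<Rightarrow> real ^ 2" where
  "polygon_vertex n j =
     vector [cos ((real j - 1) * pi / real n), sin ((real j - 1) * pi / real n)]"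

text \<open>The polygon as a curve, i.e. the boundary of the region spanned by its vertices.\<close>

definition regular_polygon :: "nat \<Rightarrow> (real ^ 2) set" where
  "regular_polygon n = frontier (convex hull (polygon_vertex n ` {1..2 * n}))"

text \<open>The vertex formula is periodic, so the index \<open>2 * n + 1\<close> needs no special treatment.\<close>

lemma polygon_vertex_wrap:
  assumes "n \<ge> 1"
  shows "polygon_vertex n (2 * n + 1) = polygon_vertex n 1"
  using assms by (simp add: polygon_vertex_def)

end

theory Submission
  imports Defs
begin

text \<open>Number the vertices \<open>v k\<close> by all integers \<open>k\<close>, and let \<open>f k\<close> be the linear functional
  that is \<open>1\<close> on the line of the edge from \<open>v k\<close> to \<open>v (k + 1)\<close>. Since the polygon is the unit
  sphere, \<open>f k \<le> N\<close> with equality on the sector spanned by that edge, so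
  \<open>N (p v k + q v (k + 1)) = p + q\<close> for \<open>p, q \<ge> 0\<close> (lemmas \<open>edge_le_N\<close> and \<open>N_sector\<close>).

  The orthogonality relation only enters as follows. A vertex is orthogonal to both of its edge
  directions. If a point inside a sector is orthogonal to \<open>y\<close>, then \<open>f k y = 0\<close>. If a positive
  multiple of \<open>v k\<close> is orthogonal to \<open>y\<close>, then \<open>f k y\<close> and \<open>f (k - 1) y\<close> are not both negative.

  Let \<open>T\<close> preserve orthogonality at \<open>v s\<close>, with \<open>u = T (v s) \<noteq> 0\<close>. Then \<open>u\<close> is orthogonal to the
  images of both edge directions at \<open>v s\<close>, whose sum is \<open>(2 cos (pi / n) - 2) u\<close> because
  \<open>v (s + 1) + v (s - 1) = 2 cos (pi / n) v s\<close>. Were \<open>u\<close> inside a sector, \<open>f k\<close> would vanish on this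
  sum, hence on \<open>u\<close>, where it is positive. So \<open>u\<close> is a positive multiple \<open>a v k\<close> of a vertex
  (lemma \<open>image_multiple_of_vertex\<close>).

  Now let \<open>T\<close> preserve orthogonality at \<open>v (s + 1)\<close> as well, with \<open>T (v (s + 1)) = b v l\<close>. The image
  \<open>b v l - a v k\<close> of the common edge is orthogonal to both \<open>a v k\<close> and \<open>b v l\<close>. As no functional
  \<open>f j\<close> exceeds \<open>1\<close> at a vertex, the first gives \<open>a \<le> b\<close> and the second \<open>b \<le> a\<close>; and once
  \<open>a = b\<close>, one of \<open>f k\<close>, \<open>f (k - 1)\<close> is \<open>1\<close> at \<open>v l\<close>, so \<open>v l\<close> is \<open>v k\<close> or one of its
  neighbours. It is not \<open>v k\<close>, because then \<open>u\<close> would be orthogonal to a nonzero multiple of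
  itself, the image of the other edge direction at \<open>v s\<close>. By the recurrence above,
  \<open>T\<close> then sends all vertices, in rotational or reflected order, to \<open>a\<close> times the vertices, and the formula for \<open>N\<close> on sectors yields \<open>N (T x) = a N x\<close>. If one of the two
  images is zero, so is the other, and \<open>T = 0\<close>.\<close>


section \<open>Directions in the plane\<close>

definition dir :: "real \<Rightarrow> real ^ 2" where
  "dir t = vector [cos t, sin t]"

lemma dir_nth [simp]: "dir t $ 1 = cos t" "dir t $ 2 = sin t"
  by (simp_all add: dir_def)

lemma inner_dir: "dir s \<bullet> dir t = cos (s - t)"
  by (simp add: inner_vec_def sum_2 cos_diff)

lemma dir_add_dir_diff: "dir (s + d) + dir (s - d) = (2 * cos d) *\<^sub>R dir s"
  by (simp add: vec_eq_iff forall_2 cos_add cos_diff sin_add sin_diff)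

text \<open>The sine rule for the triangle with sides along \<open>dir s\<close>, \<open>dir (s + d)\<close> and \<open>dir (s + r)\<close>.\<close>

lemma sin_scaleR_dir_add:
  "sin d *\<^sub>R dir (s + r) = sin (d - r) *\<^sub>R dir s + sin r *\<^sub>R dir (s + d)"
proof -
  have "sin d * cos (s + r) = sin (d - r) * cos s + sin r * cos (s + d)"
    by (simp add: cos_add sin_diff algebra_simps)
  moreover have "sin d * sin (s + r) = sin (d - r) * sin s + sin r * sin (s + d)"
    by (simp add: sin_add sin_diff algebra_simps)
  ultimately show ?thesis
    by (simp add: vec_eq_iff forall_2)
qed

lemma polar_dir: "\<exists>r t. 0 \<le> r \<and> x = r *\<^sub>R dir t"
proof -
  define z where "z = Complex (x $ 1) (x $ 2)"
  have "z = rcis (cmod z) (Arg z)"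
    by (simp add: rcis_cmod_Arg)
  then have "x $ 1 = cmod z * cos (Arg z)" "x $ 2 = cmod z * sin (Arg z)"
    by (metis Re_rcis complex.sel(1) z_def, metis Im_rcis complex.sel(2) z_def)
  then show ?thesis
    by (intro exI[of _ "cmod z"] exI[of _ "Arg z"]) (simp add: vec_eq_iff forall_2)
qed


section \<open>Vertices, sectors and edge functionals\<close>

locale polygon =
  fixes n :: nat
  assumes n_ge_2: "n \<ge> 2"
begin

definition step :: real where
  "step = pi / real n"

definition vert :: "int \<Rightarrow> real ^ 2" where
  "vert k = dir (of_int k * step)"

text \<open>The functional whose level set \<open>1\<close> is the line through \<open>vert k\<close> and \<open>vert (k + 1)\<close>; its
  gradient points to the midpoint of that edge.\<close>

definition edge :: "int \<Rightarrow> real ^ 2 \<Rightarrow> real" where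
  "edge k x = (x \<bullet> dir ((of_int k + 1 / 2) * step)) / cos (step / 2)"

lemma polygon_vertex_eq_vert: "polygon_vertex n j = vert (int j - 1)"
  by (simp add: polygon_vertex_def vert_def dir_def step_def)

lemma n_step: "real n * step = pi"
  using n_ge_2 by (simp add: step_def)

lemma step_bounds: "0 < step" "step < pi"
proof -
  show "0 < step"
    using n_ge_2 by (simp add: step_def)
  then have "1 * step < real n * step"
    using n_ge_2 by (intro mult_strict_right_mono) auto
  then show "step < pi"
    by (simp add: n_step)
qed

lemma sin_step_pos: "0 < sin step"
  using step_bounds by (intro sin_gt_zero)

lemma cos_step_less_1: "cos step < 1"
  using step_bounds cos_monotone_0_pi[of 0 step] by simp

lemma cos_half_step_pos: "0 < cos (step / 2)"
  using step_bounds by (intro cos_gt_zero) simp_all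

text \<open>This relation lets a linear map that is known at two consecutive vertices be followed around
  the whole polygon.\<close>

lemma vert_recurrence: "vert (k + 1) + vert (k - 1) = (2 * cos step) *\<^sub>R vert k"
  using dir_add_dir_diff[of "of_int k * step" step] by (simp add: vert_def algebra_simps)

lemma vert_cong:
  assumes "2 * int n dvd l - k"
  shows "vert l = vert k"
proof -
  obtain t where "l = k + 2 * int n * t"
    using assms by (metis add.commute diff_add_cancel dvdE)
  then have "of_int l * step = of_int k * step + 2 * pi * of_int t"
    by (simp add: n_step[symmetric] algebra_simps)
  then have "cos (of_int l * step) = cos (of_int k * step)"
      "sin (of_int l * step) = sin (of_int k * step)"
    by (simp_all add: cos_add sin_add cos_int_2pin sin_int_2pin)
  then show ?thesis
    by (simp add: vert_def dir_def)
qed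

lemma vert_uminus: "vert (k + int n) = - vert k"
  by (simp add: vert_def vec_eq_iff forall_2 distrib_right n_step)

lemma vert_in_polygon_vertices: "vert k \<in> polygon_vertex n ` {1..2 * n}"
proof -
  define j where "j = nat (k mod (2 * int n)) + 1"
  have pos: "0 \<le> k mod (2 * int n)" "k mod (2 * int n) < 2 * int n"
    using n_ge_2 by auto
  have "polygon_vertex n j = vert (k mod (2 * int n))"
    using pos by (simp add: polygon_vertex_eq_vert j_def)
  also have "\<dots> = vert k"
    by (intro vert_cong) (simp add: minus_mod_eq_mult_div[symmetric] mod_eq_dvd_iff[symmetric])
  finally have "vert k = polygon_vertex n j" ..
  moreover have "j \<in> {1..2 * n}"
    using pos by (auto simp: j_def)
  ultimately show ?thesis
    by blast
qed

text \<open>Among the angles that are odd multiples of \<open>step / 2\<close>, the cosine is largest at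
  \<open>\<plusminus> step / 2\<close> and, up to full turns, only there: the difference is a product of two sines
  whose arguments lie in \<open>[0, pi]\<close> once \<open>m\<close> is reduced modulo \<open>2 * n\<close>.\<close>

lemma cos_odd_half_step:
  fixes m :: int
  shows cos_odd_half_step_le: "cos ((of_int m + 1 / 2) * step) \<le> cos (step / 2)"
    and cos_odd_half_step_eq: "cos ((of_int m + 1 / 2) * step) = cos (step / 2) \<Longrightarrow>
      2 * int n dvd m \<or> 2 * int n dvd m + 1"
proof -
  define r where "r = m mod (2 * int n)"
  have r: "0 \<le> r" "r < 2 * int n"
    using n_ge_2 by (auto simp: r_def)
  have m: "m = r + 2 * int n * (m div (2 * int n))"
    by (simp add: r_def)
  have "(of_int m + 1 / 2) * step = (of_int r + 1 / 2) * step + 2 * pi * of_int (m div (2 * int n))"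
    by (subst m) (simp add: n_step[symmetric] algebra_simps)
  then have "cos ((of_int m + 1 / 2) * step) = cos ((of_int r + 1 / 2) * step)"
    by (simp add: cos_add cos_int_2pin sin_int_2pin)
  moreover have "cos (step / 2) - cos ((of_int r + 1 / 2) * step)
      = 2 * sin ((of_int r + 1) * step / 2) * sin (of_int r * step / 2)"
    using cos_diff_cos[of "step / 2" "(of_int r + 1 / 2) * step"]
    by (simp add: algebra_simps add_divide_distrib[symmetric])
  ultimately have diff: "cos (step / 2) - cos ((of_int m + 1 / 2) * step)
      = 2 * sin ((of_int r + 1) * step / 2) * sin (of_int r * step / 2)"
    by simp
  have full: "of_int (2 * int n) * step / 2 = pi"
    by (simp add: n_step)
  have le_pi: "of_int q * step / 2 \<le> pi" if "q \<le> 2 * int n" for q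
    unfolding full[symmetric] using that step_bounds(1)
    by (intro divide_right_mono mult_right_mono)
      (simp_all only: of_int_le_iff less_imp_le zero_le_numeral)
  have lt_pi: "of_int q * step / 2 < pi" if "q < 2 * int n" for q
    unfolding full[symmetric] using that step_bounds(1)
    by (intro divide_strict_right_mono mult_strict_right_mono)
      (simp_all only: of_int_less_iff zero_less_numeral)
  have "0 \<le> sin ((of_int r + 1) * step / 2)" "0 \<le> sin (of_int r * step / 2)"
    using r le_pi[of r] le_pi[of "r + 1"] step_bounds(1) by (auto intro!: sin_ge_zero)
  then show "cos ((of_int m + 1 / 2) * step) \<le> cos (step / 2)"
    using diff by (metis diff_ge_0_iff_ge mult_nonneg_nonneg zero_le_numeral)
  assume eq: "cos ((of_int m + 1 / 2) * step) = cos (step / 2)"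
  show "2 * int n dvd m \<or> 2 * int n dvd m + 1"
  proof (rule ccontr)
    assume no: "\<not> ?thesis"
    then have "0 < r"
      using r by (auto simp: r_def dvd_eq_mod_eq_0 order.order_iff_strict)
    moreover have "r + 1 \<noteq> 2 * int n"
    proof
      assume "r + 1 = 2 * int n"
      then have "m + 1 = 2 * int n * (1 + m div (2 * int n))"
        using m by (simp add: distrib_left)
      then show False
        using no by (metis dvd_triv_left)
    qed
    ultimately have "0 < sin ((of_int r + 1) * step / 2)" "0 < sin (of_int r * step / 2)"
      using r lt_pi[of r] lt_pi[of "r + 1"] step_bounds(1) by (auto intro!: sin_gt_zero)
    then show False
      using diff eq by simp
  qed
qed

lemma edge_linear:
  "edge k (x + y) = edge k x + edge k y"
  "edge k (x - y) = edge k x - edge k y"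
  "edge k (a *\<^sub>R x) = a * edge k x"
  by (simp_all add: edge_def inner_add_left inner_diff_left add_divide_distrib diff_divide_distrib)

lemma edge_vert:
  "edge k (vert j) = cos ((of_int (j - k - 1) + 1 / 2) * step) / cos (step / 2)"
proof -
  have "of_int j * step - (of_int k + 1 / 2) * step = (of_int (j - k - 1) + 1 / 2) * step"
    by (simp add: algebra_simps)
  then show ?thesis
    by (simp add: edge_def vert_def inner_dir)
qed

lemma edge_vert_le_1: "edge k (vert j) \<le> 1"
  using cos_odd_half_step_le[of "j - k - 1"] cos_half_step_pos by (simp add: edge_vert)

text \<open>The line of an edge meets the set of vertices only in the two ends of that edge.\<close>

lemma edge_vert_eq_1D:
  assumes "edge k (vert j) = 1"
  shows "2 * int n dvd j - (k + 1) \<or> 2 * int n dvd j - k"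
  using cos_odd_half_step_eq[of "j - k - 1"] assms cos_half_step_pos
  by (simp add: edge_vert algebra_simps)

lemma edge_endpoints [simp]: "edge k (vert k) = 1" "edge k (vert (k + 1)) = 1"
proof -
  have "cos ((of_int (- 1) + 1 / 2) * step) = cos (step / 2)"
    using cos_minus[of "step / 2"] by simp
  then show "edge k (vert k) = 1"
    using cos_half_step_pos by (simp add: edge_vert)
  show "edge k (vert (k + 1)) = 1"
    using cos_half_step_pos by (simp add: edge_vert)
qed

lemma dir_in_basis:
  "\<rho> *\<^sub>R dir t = (\<rho> * sin (step - (t - of_int k * step)) / sin step) *\<^sub>R vert k
     + (\<rho> * sin (t - of_int k * step) / sin step) *\<^sub>R vert (k + 1)"
proof -
  have "sin step *\<^sub>R dir t = sin (step - (t - of_int k * step)) *\<^sub>R vert k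
      + sin (t - of_int k * step) *\<^sub>R vert (k + 1)"
    using sin_scaleR_dir_add[of step "of_int k * step" "t - of_int k * step"]
    by (simp add: vert_def algebra_simps)
  then have "(\<rho> / sin step) *\<^sub>R (sin step *\<^sub>R dir t) =
      (\<rho> / sin step) *\<^sub>R (sin (step - (t - of_int k * step)) *\<^sub>R vert k
      + sin (t - of_int k * step) *\<^sub>R vert (k + 1))"
    by simp
  then show ?thesis
    using sin_step_pos by (simp add: scaleR_add_right)
qed

lemma basis_expansion: "\<exists>\<alpha> \<beta>. x = \<alpha> *\<^sub>R vert k + \<beta> *\<^sub>R vert (k + 1)"
  using polar_dir[of x] dir_in_basis by metis

text \<open>The sector is found from the polar angle of \<open>x\<close>; both sines in \<open>dir_in_basis\<close> are then
  nonnegative.\<close>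

lemma sector_cover:
  "\<exists>k p q. 0 \<le> p \<and> 0 \<le> q \<and> x = p *\<^sub>R vert k + q *\<^sub>R vert (k + 1)"
proof -
  obtain \<rho> t where x: "0 \<le> \<rho>" "x = \<rho> *\<^sub>R dir t"
    using polar_dir by blast
  define k where "k = \<lfloor>t / step\<rfloor>"
  define r where "r = t - of_int k * step"
  have "of_int k \<le> t / step" "t / step < of_int k + 1"
    by (simp_all add: k_def)
  then have "of_int k * step \<le> t" "t < (of_int k + 1) * step"
    using step_bounds(1) by (simp_all only: pos_le_divide_eq pos_divide_less_eq)
  then have r: "0 \<le> r" "r \<le> step"
    by (simp_all add: r_def distrib_right)
  have "0 \<le> sin (step - r)" "0 \<le> sin r"
    using r step_bounds(2) by (intro sin_ge_zero; linarith)+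
  then have "0 \<le> \<rho> * sin (step - r) / sin step" "0 \<le> \<rho> * sin r / sin step"
    using x(1) sin_step_pos by (auto intro!: divide_nonneg_nonneg mult_nonneg_nonneg)
  then show ?thesis
    using x(2) dir_in_basis[of \<rho> t k] unfolding r_def by blast
qed

end


section \<open>The norm and its orthogonality relation\<close>

text \<open>This keeps the coordinates \<open>p - c * a\<close> and \<open>q - c * b\<close> of a point nonnegative when it is
  moved a little against a direction with coordinates \<open>a\<close> and \<open>b\<close>, so that it stays in its
  sector.\<close>

lemma small_multiple_le:
  fixes a b p q :: real
  assumes "0 < p" "0 < q"
  shows "\<exists>c>0. c * a \<le> p \<and> c * b \<le> q"
proof -
  have "((\<lambda>c. c * a) \<longlongrightarrow> 0 * a) (at_right 0)" "((\<lambda>c. c * b) \<longlongrightarrow> 0 * b) (at_right 0)"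
    by (intro tendsto_intros)+
  then have "eventually (\<lambda>c. c * a < p) (at_right 0)" "eventually (\<lambda>c. c * b < q) (at_right 0)"
    using assms by (auto dest: order_tendstoD(2))
  moreover have "eventually (\<lambda>c::real. 0 < c) (at_right 0)"
    by (simp add: eventually_at_right_less)
  ultimately have "eventually (\<lambda>c. 0 < c \<and> c * a \<le> p \<and> c * b \<le> q) (at_right 0)"
    by eventually_elim auto
  then show ?thesis
    using eventually_happens'[OF trivial_limit_at_right_real] by blast
qed

locale polygon_norm = polygon +
  fixes N :: "real ^ 2 \<Rightarrow> real"
  assumes norm_N: "is_norm N"
    and sphere_N: "unit_sphere N = regular_polygon n"
begin

lemma N_nonneg: "0 \<le> N x"
  and N_zero_iff: "N x = 0 \<longleftrightarrow> x = 0"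
  and N_scaleR: "N (a *\<^sub>R x) = \<bar>a\<bar> * N x"
  and N_triangle: "N (x + y) \<le> N x + N y"
  using norm_N by (auto simp: is_norm_def)

lemma N_pos: "x \<noteq> 0 \<Longrightarrow> 0 < N x"
  using N_nonneg[of x] N_zero_iff[of x] by linarith

abbreviation region :: "(real ^ 2) set" where
  "region \<equiv> convex hull (polygon_vertex n ` {1..2 * n})"

lemma vert_in_hull: "vert k \<in> region"
  by (rule hull_inc, rule vert_in_polygon_vertices)

lemma normalized_in_frontier: "x \<noteq> 0 \<Longrightarrow> (1 / N x) *\<^sub>R x \<in> frontier region"
  unfolding regular_polygon_def[symmetric] sphere_N[symmetric]
  using N_pos[of x] by (simp add: unit_sphere_def N_scaleR)

text \<open>The origin is the midpoint of two opposite vertices. It is not a boundary point, since boundary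
  points have norm \<open>1\<close>.\<close>

lemma zero_in_interior_hull: "0 \<in> interior region"
proof -
  have "(1 / 2) *\<^sub>R vert 0 + (1 / 2) *\<^sub>R vert (0 + int n) \<in> region"
    by (intro convexD[OF convex_convex_hull] vert_in_hull) auto
  then have "0 \<in> region"
    by (simp only: vert_uminus) simp
  moreover have "0 \<notin> frontier region"
    unfolding regular_polygon_def[symmetric] sphere_N[symmetric]
    using N_zero_iff[of 0] by (simp add: unit_sphere_def)
  ultimately show ?thesis
    using closure_subset by (auto simp: frontier_def)
qed

text \<open>A vertex of norm greater than \<open>1\<close> would shrink to a point of the unit sphere, hence of the
  boundary; but shrinking a point of a convex set towards an interior point gives an interior
  point.\<close>

lemma N_vert_le_1: "N (vert k) \<le> 1"
proof (rule ccontr)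
  assume "\<not> ?thesis"
  then have gt: "1 < N (vert k)"
    by simp
  define e where "e = 1 - 1 / N (vert k)"
  have "0 < e" "e \<le> 1"
    using gt by (simp_all add: e_def)
  then have "vert k - e *\<^sub>R (vert k - 0) \<in> interior region"
    by (intro mem_interior_convex_shrink convex_convex_hull zero_in_interior_hull vert_in_hull)
  then have "(1 / N (vert k)) *\<^sub>R vert k \<in> interior region"
    by (simp add: e_def scaleR_diff_left)
  moreover have "vert k \<noteq> 0"
    using gt N_zero_iff[of 0] by auto
  ultimately show False
    using normalized_in_frontier by (auto simp: frontier_def)
qed

lemma edge_le_1_on_hull: "x \<in> region \<Longrightarrow> edge k x \<le> 1"
proof -
  assume x: "x \<in> region"
  have "region \<subseteq> {x. edge k x \<le> 1}"
  proof (rule hull_minimal)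
    show "polygon_vertex n ` {1..2 * n} \<subseteq> {x. edge k x \<le> 1}"
      by (auto simp: polygon_vertex_eq_vert edge_vert_le_1)
    show "convex {x. edge k x \<le> 1}"
      by (auto simp: convex_def edge_linear intro: convex_bound_le)
  qed
  then show ?thesis
    using x by auto
qed

text \<open>Every vector is a multiple of a point of the polygon, where \<open>edge k\<close> is at most \<open>1\<close>.\<close>

lemma edge_le_N: "edge k x \<le> N x"
proof (cases "x = 0")
  case True
  then show ?thesis
    using N_zero_iff[of 0] by (simp add: edge_def)
next
  case False
  have "closed region"
    by (intro compact_imp_closed finite_imp_compact_convex_hull) auto
  then have "(1 / N x) *\<^sub>R x \<in> region"
    using normalized_in_frontier[OF False] by (auto simp: frontier_def closure_closed)
  then have "edge k ((1 / N x) *\<^sub>R x) \<le> 1"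
    by (rule edge_le_1_on_hull)
  then show ?thesis
    using N_pos[OF False] by (simp add: edge_linear field_simps)
qed

lemma N_combination_le:
  assumes "0 \<le> p" "0 \<le> q"
  shows "N (p *\<^sub>R vert k + q *\<^sub>R vert l) \<le> p + q"
proof -
  have "N (p *\<^sub>R vert k + q *\<^sub>R vert l) \<le> p * N (vert k) + q * N (vert l)"
    using N_triangle[of "p *\<^sub>R vert k" "q *\<^sub>R vert l"] assms by (simp add: N_scaleR)
  also have "\<dots> \<le> p * 1 + q * 1"
    by (intro add_mono mult_left_mono N_vert_le_1 assms)
  finally show ?thesis
    by simp
qed

text \<open>The triangle inequality bounds the norm from above, the functional of the edge from below.\<close>

lemma N_sector:
  assumes "0 \<le> p" "0 \<le> q"
  shows "N (p *\<^sub>R vert k + q *\<^sub>R vert (k + 1)) = p + q"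
  using N_combination_le[OF assms] edge_le_N[of k "p *\<^sub>R vert k + q *\<^sub>R vert (k + 1)"]
  by (intro antisym) (simp_all add: edge_linear)

lemma N_vert [simp]: "N (vert k) = 1"
  using N_sector[of 1 0 k] by simp

abbreviation bj :: "real ^ 2 \<Rightarrow> real ^ 2 \<Rightarrow> bool" where
  "bj \<equiv> birkhoff_james N"

lemma bj_uminus: "bj x y \<Longrightarrow> bj x (- y)"
  unfolding birkhoff_james_def by (metis scaleR_minus_left scaleR_minus_right)

lemma bj_self_scaleR:
  assumes "bj x (a *\<^sub>R x)" "a \<noteq> 0"
  shows "x = 0"
proof -
  have "N x \<le> N (x + (- 1 / a) *\<^sub>R (a *\<^sub>R x))"
    using assms(1) unfolding birkhoff_james_def by blast
  then have "N x \<le> N 0"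
    using assms(2) by simp
  then show ?thesis
    using N_zero_iff[of 0] N_pos[of x] by fastforce
qed

text \<open>Along the line through \<open>x\<close> in direction \<open>y\<close> the lower bound \<open>edge k\<close> of the norm is constant,
  and the norm attains it at \<open>x\<close>.\<close>

lemma bj_if_edge_eq_0:
  assumes "edge k x = N x" "edge k y = 0"
  shows "bj x y"
  unfolding birkhoff_james_def
proof
  fix c
  have "edge k (x + c *\<^sub>R y) = N x"
    using assms by (simp add: edge_linear)
  then show "N x \<le> N (x + c *\<^sub>R y)"
    using edge_le_N by metis
qed

lemma bj_vert_next: "bj (vert k) (vert (k + 1) - vert k)"
  by (rule bj_if_edge_eq_0[of k]) (simp_all add: edge_linear)

lemma bj_vert_prev: "bj (vert k) (vert (k - 1) - vert k)"
  using edge_endpoints(2)[of "k - 1"]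
  by (intro bj_if_edge_eq_0[of "k - 1"]) (simp_all add: edge_linear)

text \<open>A small step from the point against \<open>y\<close> stays in the sector, where the norm is \<open>edge k\<close>, and
  so decreases the norm.\<close>

lemma not_bj_interior_pos:
  assumes "0 < p" "0 < q" "0 < edge k y"
  shows "\<not> bj (p *\<^sub>R vert k + q *\<^sub>R vert (k + 1)) y"
proof
  assume bj: "bj (p *\<^sub>R vert k + q *\<^sub>R vert (k + 1)) y"
  obtain \<alpha> \<beta> where y: "y = \<alpha> *\<^sub>R vert k + \<beta> *\<^sub>R vert (k + 1)"
    using basis_expansion by blast
  obtain c where c: "0 < c" "c * \<alpha> \<le> p" "c * \<beta> \<le> q"
    using small_multiple_le assms by blast
  have "p *\<^sub>R vert k + q *\<^sub>R vert (k + 1) + (- c) *\<^sub>R y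
      = (p - c * \<alpha>) *\<^sub>R vert k + (q - c * \<beta>) *\<^sub>R vert (k + 1)"
    by (simp add: y algebra_simps)
  then have "p + q \<le> p - c * \<alpha> + (q - c * \<beta>)"
    using bj N_sector[of p q k] N_sector[of "p - c * \<alpha>" "q - c * \<beta>" k] assms c
    unfolding birkhoff_james_def by (metis diff_ge_0_iff_ge less_imp_le)
  moreover have "0 < c * (\<alpha> + \<beta>)"
    using c(1) assms(3) by (simp add: y edge_linear)
  ultimately show False
    by (simp add: distrib_left)
qed

lemma bj_interior:
  assumes "0 < p" "0 < q" "bj (p *\<^sub>R vert k + q *\<^sub>R vert (k + 1)) y"
  shows "edge k y = 0"
proof -
  have "edge k (- y) = - edge k y"
    by (simp add: edge_def)
  then show ?thesis
    using not_bj_interior_pos[of p q k y] not_bj_interior_pos[of p q k "- y"] assms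
      bj_uminus by force
qed

text \<open>A small step from the vertex against \<open>y\<close> enters one of the two sectors that meet there. On these
  the norm is \<open>edge k\<close> or \<open>edge (k - 1)\<close>, and both decrease.\<close>

lemma not_bj_vertex_pos:
  assumes "0 < a" "0 < edge k y" "0 < edge (k - 1) y"
  shows "\<not> bj (a *\<^sub>R vert k) y"
proof
  assume bj: "bj (a *\<^sub>R vert k) y"
  obtain \<alpha> \<beta> where y: "y = \<alpha> *\<^sub>R vert k + \<beta> *\<^sub>R vert (k + 1)"
    using basis_expansion by blast
  define \<gamma> where "\<gamma> = \<alpha> + 2 * cos step * \<beta>"
  have v_next: "vert (k + 1) = (2 * cos step) *\<^sub>R vert k - vert (k - 1)"
    using vert_recurrence[of k] by (simp add: eq_diff_eq)
  have y': "y = \<gamma> *\<^sub>R vert k - \<beta> *\<^sub>R vert (k - 1)"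
    unfolding y v_next \<gamma>_def by (simp add: algebra_simps)
  have pos: "0 < \<alpha> + \<beta>" "0 < \<gamma> - \<beta>"
    using assms(2,3) edge_endpoints[of "k - 1"]
    by (simp add: y edge_linear, simp add: y' edge_linear)
  obtain c where c: "0 < c" "c * \<alpha> \<le> a" "c * \<gamma> \<le> a"
    using small_multiple_le[of a a \<alpha> \<gamma>] assms(1) by blast
  have low: "a \<le> N (a *\<^sub>R vert k + (- c) *\<^sub>R y)"
    using bj assms(1) unfolding birkhoff_james_def
    by (metis N_scaleR N_vert abs_of_pos mult.right_neutral)
  \<comment> \<open>The sign of \<open>\<beta>\<close> tells on which side of the line through \<open>vert k\<close> the step ends.\<close>
  show False
  proof (cases "\<beta> \<le> 0")
    case True
    have "a *\<^sub>R vert k + (- c) *\<^sub>R y = (a - c * \<alpha>) *\<^sub>R vert k + (c * (- \<beta>)) *\<^sub>R vert (k + 1)"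
      by (simp add: y algebra_simps)
    also have "N \<dots> \<le> (a - c * \<alpha>) + c * (- \<beta>)"
      using c True by (intro N_combination_le mult_nonneg_nonneg) auto
    also have "\<dots> = a - c * (\<alpha> + \<beta>)"
      by (simp add: algebra_simps)
    finally show False
      using low mult_pos_pos[OF c(1) pos(1)] by simp
  next
    case False
    have "a *\<^sub>R vert k + (- c) *\<^sub>R y = (a - c * \<gamma>) *\<^sub>R vert k + (c * \<beta>) *\<^sub>R vert (k - 1)"
      by (simp add: y' algebra_simps)
    also have "N \<dots> \<le> (a - c * \<gamma>) + c * \<beta>"
      using c False by (intro N_combination_le mult_nonneg_nonneg) auto
    also have "\<dots> = a - c * (\<gamma> - \<beta>)"
      by (simp add: algebra_simps)
    finally show False
      using low mult_pos_pos[OF c(1) pos(2)] by simp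
  qed
qed

lemma bj_vertex_nonneg:
  assumes "0 < a" "bj (a *\<^sub>R vert k) y"
  shows "0 \<le> edge k y \<or> 0 \<le> edge (k - 1) y"
proof -
  have "edge j (- y) = - edge j y" for j
    by (simp add: edge_def)
  then show ?thesis
    using not_bj_vertex_pos[of a k "- y"] bj_uminus assms by force
qed


section \<open>Operators that preserve orthogonality at a vertex\<close>

lemma image_of_vertex:
  assumes "linear T" "preserves_birkhoff_james_at N T (vert s)"
  shows image_bj_next: "bj (T (vert s)) (T (vert (s + 1)) - T (vert s))"
    and image_bj_prev: "bj (T (vert s)) (T (vert (s - 1)) - T (vert s))"
  using bj_vert_next[of s] bj_vert_prev[of s] assms
  unfolding preserves_birkhoff_james_at_def by (metis linear_diff)+

lemma image_recurrence:
  assumes "linear T"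
  shows "T (vert (k + 1)) + T (vert (k - 1)) = (2 * cos step) *\<^sub>R T (vert k)"
  using arg_cong[OF vert_recurrence[of k], of T] assms by (simp add: linear_add linear_cmul)

text \<open>Inside a sector the norm is smooth, so orthogonality to both edge images would put both in the
  kernel of \<open>edge k\<close>; by the recurrence their sum is a nonzero multiple of \<open>T (vert s)\<close>, on which
  \<open>edge k\<close> does not vanish.\<close>

lemma image_multiple_of_vertex:
  assumes "linear T" "preserves_birkhoff_james_at N T (vert s)" "T (vert s) \<noteq> 0"
  shows "\<exists>a k. 0 < a \<and> T (vert s) = a *\<^sub>R vert k"
proof -
  obtain k p q where pq: "0 \<le> p" "0 \<le> q"
    and u: "T (vert s) = p *\<^sub>R vert k + q *\<^sub>R vert (k + 1)"
    using sector_cover by blast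
  have "p = 0 \<or> q = 0"
  proof (rule ccontr)
    assume "\<not> ?thesis"
    then have pos: "0 < p" "0 < q"
      using pq by auto
    let ?u = "T (vert s)"
    have "edge k (T (vert (s + 1)) - ?u) = 0" "edge k (T (vert (s - 1)) - ?u) = 0"
      using image_of_vertex[OF assms(1,2)] bj_interior[OF pos] unfolding u by auto
    then have "edge k (T (vert (s + 1)) + T (vert (s - 1))) = 2 * edge k ?u"
      by (simp add: edge_linear)
    then have "(2 * cos step) * edge k ?u = 2 * edge k ?u"
      by (simp add: image_recurrence[OF assms(1)] edge_linear)
    moreover have "edge k ?u \<noteq> 0"
      using pos by (simp add: u edge_linear)
    ultimately show False
      using cos_step_less_1 by simp
  qed
  then show ?thesis
  proof
    assume "p = 0"
    then show ?thesis
      using u pq assms(3) by (intro exI[of _ q] exI[of _ "k + 1"]) (auto simp: less_le)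
  next
    assume "q = 0"
    then show ?thesis
      using u pq assms(3) by (intro exI[of _ p] exI[of _ k]) (auto simp: less_le)
  qed
qed

text \<open>One of the two edge functionals at \<open>vert k\<close> is nonnegative on the difference; it has the value
  \<open>a\<close> at \<open>a *\<^sub>R vert k\<close> and at most \<open>b\<close> at \<open>b *\<^sub>R vert l\<close>.\<close>

lemma bj_vertex_difference_le:
  assumes "0 < a" "0 < b" "bj (a *\<^sub>R vert k) (b *\<^sub>R vert l - a *\<^sub>R vert k)"
  shows "a \<le> b"
proof -
  have "a \<le> b" if "0 \<le> edge j (b *\<^sub>R vert l - a *\<^sub>R vert k)" "edge j (vert k) = 1" for j
  proof -
    have "a \<le> b * edge j (vert l)"
      using that by (simp add: edge_linear)
    also have "\<dots> \<le> b * 1"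
      using edge_vert_le_1 assms(2) by (intro mult_left_mono) auto
    finally show ?thesis
      by simp
  qed
  then show ?thesis
    using bj_vertex_nonneg[OF assms(1,3)] edge_endpoints(2)[of "k - 1"] by auto
qed

text \<open>The equality case of the preceding comparison: \<open>vert l\<close> lies on the line of an edge at
  \<open>vert k\<close>.\<close>

lemma bj_vertex_difference_adjacent:
  assumes "0 < a" "bj (a *\<^sub>R vert k) (a *\<^sub>R vert l - a *\<^sub>R vert k)"
  shows "vert l \<in> {vert (k - 1), vert k, vert (k + 1)}"
proof -
  have eq: "edge j (vert l) = 1"
    if "0 \<le> edge j (a *\<^sub>R vert l - a *\<^sub>R vert k)" "edge j (vert k) = 1" for j
  proof -
    have "a * 1 \<le> a * edge j (vert l)"
      using that by (simp add: edge_linear)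
    then have "1 \<le> edge j (vert l)"
      using assms(1) by (simp only: mult_le_cancel_left_pos)
    then show ?thesis
      using edge_vert_le_1[of j l] by linarith
  qed
  have "edge k (vert l) = 1 \<or> edge (k - 1) (vert l) = 1"
    using bj_vertex_nonneg[OF assms] eq[of k] eq[of "k - 1"] edge_endpoints(2)[of "k - 1"] by auto
  then show ?thesis
    using edge_vert_eq_1D[of k l] edge_vert_eq_1D[of "k - 1" l] vert_cong by auto
qed

text \<open>The sign \<open>\<epsilon>\<close> distinguishes rotations from reflections. Both sides satisfy the same second-order
  recurrence in \<open>m\<close>, which can be run in both directions.\<close>

lemma image_of_all_vertices:
  assumes "linear T" "\<epsilon> \<in> {- 1, 1}"
    and "T (vert s) = a *\<^sub>R vert k" "T (vert (s + 1)) = a *\<^sub>R vert (k + \<epsilon>)"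
  shows "T (vert (s + m)) = a *\<^sub>R vert (k + \<epsilon> * m)"
proof -
  define P where "P m \<longleftrightarrow> T (vert (s + m)) = a *\<^sub>R vert (k + \<epsilon> * m)" for m
  have rec: "T (vert (s + m + 1)) - a *\<^sub>R vert (k + \<epsilon> * m + \<epsilon>)
      = (2 * cos step) *\<^sub>R (T (vert (s + m)) - a *\<^sub>R vert (k + \<epsilon> * m))
        - (T (vert (s + m - 1)) - a *\<^sub>R vert (k + \<epsilon> * m - \<epsilon>))" for m
  proof -
    have T: "T (vert (s + m + 1)) = (2 * cos step) *\<^sub>R T (vert (s + m)) - T (vert (s + m - 1))"
      using image_recurrence[OF assms(1), of "s + m"] by (simp add: eq_diff_eq)
    have v: "vert (k + \<epsilon> * m + \<epsilon>) = (2 * cos step) *\<^sub>R vert (k + \<epsilon> * m) - vert (k + \<epsilon> * m - \<epsilon>)"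
      using assms(2) vert_recurrence[of "k + \<epsilon> * m"] by (auto simp: eq_diff_eq add.commute)
    show ?thesis
      unfolding T v by (simp add: algebra_simps)
  qed
  have up: "P (m + 1)" if "P m" "P (m - 1)" for m
    using rec[of m] that by (simp add: P_def algebra_simps)
  have down: "P (m - 1)" if "P m" "P (m + 1)" for m
    using rec[of m] that by (simp add: P_def algebra_simps)
  have "P 0" "P 1"
    using assms by (simp_all add: P_def)
  have "P m \<and> P (m + 1)"
  proof (induction m rule: int_induct[of _ 0])
    case base
    show ?case
      using \<open>P 0\<close> \<open>P 1\<close> by simp
  next
    case (step1 i)
    then show ?case
      using up[of "i + 1"] by simp
  next
    case (step2 i)
    then show ?case
      using down[of i] by simp
  qed
  then show ?thesis
    by (simp add: P_def)
qed

text \<open>\<open>T\<close> maps each sector onto a sector, and multiplies the two coordinates of a point in it by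
  \<open>a\<close>.\<close>

lemma image_norm:
  assumes "linear T" "0 < a" "\<epsilon> \<in> {- 1, 1}"
    and "T (vert s) = a *\<^sub>R vert k" "T (vert (s + 1)) = a *\<^sub>R vert (k + \<epsilon>)"
  shows "N (T x) = a * N x"
proof -
  obtain j p q where pq: "0 \<le> p" "0 \<le> q" and x: "x = p *\<^sub>R vert j + q *\<^sub>R vert (j + 1)"
    using sector_cover by blast
  define l where "l = k + \<epsilon> * (j - s)"
  have "T (vert j) = a *\<^sub>R vert l"
    using image_of_all_vertices[OF assms(1,3-5), of "j - s"] by (simp add: l_def)
  moreover have "T (vert (j + 1)) = a *\<^sub>R vert (l + \<epsilon>)"
    using image_of_all_vertices[OF assms(1,3-5), of "j + 1 - s"] by (simp add: l_def algebra_simps)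
  ultimately have "T x = a *\<^sub>R (p *\<^sub>R vert l + q *\<^sub>R vert (l + \<epsilon>))"
    using assms(1) by (simp add: x linear_add linear_cmul algebra_simps)
  moreover have "N (p *\<^sub>R vert l + q *\<^sub>R vert (l + \<epsilon>)) = p + q"
    using assms(3) N_sector[OF pq, of l] N_sector[OF pq(2,1), of "l - 1"]
    by (auto simp: add.commute)
  ultimately show ?thesis
    using assms(2) N_sector[OF pq] by (simp add: N_scaleR x)
qed

lemma scaled_isometryI:
  assumes "linear T" "0 < a" "\<And>x. N (T x) = a * N x"
  shows "\<exists>c S. linear_isometry N S \<and> T = (\<lambda>x. c *\<^sub>R S x)"
proof (intro exI conjI)
  show "T = (\<lambda>x. a *\<^sub>R ((1 / a) *\<^sub>R T x))"
    using assms(2) by simp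
  show "linear_isometry N (\<lambda>x. (1 / a) *\<^sub>R T x)"
    using assms by (simp add: linear_isometry_def N_scaleR linear_compose_scale_right)
qed

text \<open>If one of these failed, an edge image at \<open>vert s\<close> would be a nonzero multiple of \<open>T (vert s)\<close>,
  and no nonzero vector is orthogonal to such a multiple.\<close>

lemma images_not_equal_or_zero:
  assumes "linear T" "preserves_birkhoff_james_at N T (vert s)" "T (vert s) \<noteq> 0"
  shows "T (vert (s + 1)) \<noteq> 0" "T (vert (s - 1)) \<noteq> 0" "T (vert (s + 1)) \<noteq> T (vert s)"
proof -
  let ?u = "T (vert s)"
  note to_next = image_bj_next[OF assms(1,2)] and to_prev = image_bj_prev[OF assms(1,2)]
  show "T (vert (s + 1)) \<noteq> 0" "T (vert (s - 1)) \<noteq> 0"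
    using bj_self_scaleR[of ?u "- 1"] to_next to_prev assms(3) by auto
  show "T (vert (s + 1)) \<noteq> ?u"
  proof
    assume "T (vert (s + 1)) = ?u"
    then have "T (vert (s - 1)) = (2 * cos step - 1) *\<^sub>R ?u"
      using image_recurrence[OF assms(1), of s] by (simp add: scaleR_diff_left eq_diff_eq add.commute)
    then have "T (vert (s - 1)) - ?u = (2 * cos step - 2) *\<^sub>R ?u"
      by (simp add: scaleR_diff_left scaleR_2)
    then show False
      using to_prev bj_self_scaleR[of ?u "2 * cos step - 2"] assms(3) cos_step_less_1 by auto
  qed
qed

lemma preserving_imp_scaled_isometry:
  assumes "linear T" "preserves_birkhoff_james_at N T (vert s)"
    and "preserves_birkhoff_james_at N T (vert (s + 1))"
  shows "\<exists>c S. linear_isometry N S \<and> T = (\<lambda>x. c *\<^sub>R S x)"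
proof (cases "T (vert s) = 0")
  case True
  then have "T (vert (s + 1)) = 0"
    using images_not_equal_or_zero(2)[OF assms(1,3)] by auto
  then have "T x = 0" for x
    using basis_expansion[of x s] True assms(1) by (auto simp: linear_add linear_cmul)
  then show ?thesis
    by (intro exI[of _ 0] exI[of _ "\<lambda>x. x"]) (auto simp: linear_isometry_def linear_iff)
next
  case False
  note neq = images_not_equal_or_zero[OF assms(1,2) False]
  obtain a k where u: "0 < a" "T (vert s) = a *\<^sub>R vert k"
    using image_multiple_of_vertex[OF assms(1,2) False] by blast
  obtain b l where v: "0 < b" "T (vert (s + 1)) = b *\<^sub>R vert l"
    using image_multiple_of_vertex[OF assms(1,3) neq(1)] by blast
  have bj: "bj (a *\<^sub>R vert k) (b *\<^sub>R vert l - a *\<^sub>R vert k)"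
    using image_bj_next[OF assms(1,2)] u v by simp
  have "bj (b *\<^sub>R vert l) (a *\<^sub>R vert k - b *\<^sub>R vert l)"
    using image_bj_prev[OF assms(1,3)] u v by simp
  then have "a = b"
    using bj u v bj_vertex_difference_le by (meson antisym)
  then have "vert l \<in> {vert (k - 1), vert k, vert (k + 1)}"
    using bj u bj_vertex_difference_adjacent by blast
  moreover have "vert l \<noteq> vert k"
    using neq(3) u v \<open>a = b\<close> by auto
  ultimately obtain \<epsilon> where "\<epsilon> \<in> {- 1, 1}" "vert l = vert (k + \<epsilon>)"
    by force
  then have "N (T x) = a * N x" for x
    using image_norm[OF assms(1) u(1) _ u(2), of \<epsilon>] v \<open>a = b\<close> by simp
  then show ?thesis
    using scaled_isometryI assms(1) u(1) by blast
qed

end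


section \<open>The regular polygon space\<close>

theorem theorem2p16:
  fixes n i :: nat
    and N :: "real ^ 2 \<Rightarrow> real"
    and T :: "real ^ 2 \<Rightarrow> real ^ 2"
  assumes "n \<ge> 2"
    and "is_norm N"
    and "unit_sphere N = regular_polygon n"
    and "linear T"
    and "1 \<le> i" and "i \<le> 2 * n"
    and "preserves_birkhoff_james_at N T (polygon_vertex n i)"
    and "preserves_birkhoff_james_at N T (polygon_vertex n (i + 1))"
  shows "\<exists>(c::real) S. linear_isometry N S \<and> T = (\<lambda>x. c *\<^sub>R S x)"
proof -
  interpret polygon_norm n N
    using assms by unfold_locales
  show ?thesis
    using assms(7,8) preserving_imp_scaled_isometry[OF assms(4), of "int i - 1"]
    by (simp add: polygon_vertex_eq_vert)
qed

end
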